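(* Let $G=(V,E)$ be a finite simple graph, $R$ a commutative unital ring, and $w_{ij}=w_{ji}\in R$ ($i,j\in V$) symmetric weights with $w_{ii}=0$ and $w_{ij}=0$ whenever $ij\notin E$. The graph bracket $[f,g]_i=\sum_{j}w_{ij}(f_ig_j-f_jg_i)$ on $R^V$ satisfies the Jacobi identity if and only if, for every three distinct vertices $a,b,c\in V$, $$w_{bc}(w_{ab}-w_{ac})=0,\qquad w_{ac}(w_{bc}-w_{ab})=0,\qquad w_{ab}(w_{ac}-w_{bc})=0 .$$ In particular, the incident-annihilation condition, namely $w_{ij}w_{ik}=0$ for all $i,j,k\in V$ with $j\neq k$, is sufficient for the Jacobi identity.
   Context: The graph bracket is the $R$-bilinear antisymmetric map $[\,,\,]:R^V\times R^V\to R^V$ given by $[f,g]_i=\sum_{j\in V}w_{ij}(f_ig_j-f_jg_i)$. The Jacobi identity is $[f,[g,h]]+[g,[h,f]]+[h,[f,g]]=0$ for all $f,g,h\in R^V$. *)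

theory Defs
  imports "Graph_Theory.Digraph" "HOL-Library.FuncSet"
begin

text \<open>
  The module \<open>R\<^sup>V\<close> is the set of extensional functions \<open>V \<rightarrow>\<^sub>E UNIV\<close>, where \<open>R\<close> is
  the ambient type. The coefficients range over \<open>{comm_ring, comm_monoid_mult}\<close>, that is,
  commutative unital rings; unlike \<open>comm_ring_1\<close>, this sort does not demand \<open>0 \<noteq> 1\<close> and
  so includes the zero ring.
\<close>

definition graph_bracket ::
  "'v set \<Rightarrow> ('v \<Rightarrow> 'v \<Rightarrow> 'a::{comm_ring, comm_monoid_mult}) \<Rightarrow> ('v \<Rightarrow> 'a) \<Rightarrow> ('v \<Rightarrow> 'a) \<Rightarrow> 'v \<Rightarrow> 'a"
  where "graph_bracket V w f g = (\<lambda>i\<in>V. \<Sum>j\<in>V. w i j * (f i * g j - f j * g i))"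

definition jacobi_identity ::
  "'v set \<Rightarrow> (('v \<Rightarrow> 'a::{comm_ring, comm_monoid_mult}) \<Rightarrow> ('v \<Rightarrow> 'a) \<Rightarrow> 'v \<Rightarrow> 'a) \<Rightarrow> bool"
  where "jacobi_identity V br \<longleftrightarrow>
    (\<forall>f \<in> V \<rightarrow>\<^sub>E UNIV. \<forall>g \<in> V \<rightarrow>\<^sub>E UNIV. \<forall>h \<in> V \<rightarrow>\<^sub>E UNIV. \<forall>i \<in> V.
       br f (br g h) i + br g (br h f) i + br h (br f g) i = 0)"

definition incident_annihilation ::
  "'v set \<Rightarrow> ('v \<Rightarrow> 'v \<Rightarrow> 'a::{comm_ring, comm_monoid_mult}) \<Rightarrow> bool"
  where "incident_annihilation V w \<longleftrightarrow>
    (\<forall>i\<in>V. \<forall>j\<in>V. \<forall>k\<in>V. j \<noteq> k \<longrightarrow> w i j * w i k = 0)"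

end

theory Submission
  imports Defs
begin

text \<open>
  The part of the Jacobiator at \<open>i\<close> carrying the weights \<open>w i j * w i k\<close> cancels, these weights being
  symmetric in \<open>j\<close>, \<open>k\<close>. What remains is the sum of \<open>w i j * w j k\<close> times the
  \<open>3\<times>3\<close> determinant of \<open>f\<close>, \<open>g\<close>, \<open>h\<close> at \<open>i\<close>, \<open>j\<close>, \<open>k\<close>. The determinant is alternating, so
  the sum vanishes as soon as the weights are symmetric in \<open>j\<close>, \<open>k\<close> for distinct \<open>i\<close>, \<open>j\<close>, \<open>k\<close>;
  evaluating at basis vectors shows that this is also necessary.
\<close>

text \<open>Splits the nested bracket by the shape of its weights: walks \<open>i\<close>,
  \<open>j\<close>, \<open>k\<close> in the first sum, two weights meeting at \<open>i\<close> in
  the second. Only the first kind survives the cyclic sum.\<close>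

lemma graph_bracket_nested:
  fixes w :: "'v \<Rightarrow> 'v \<Rightarrow> 'a::{comm_ring, comm_monoid_mult}"
  assumes "i \<in> V"
  shows "graph_bracket V w f (graph_bracket V w g h) i =
    (\<Sum>j\<in>V. \<Sum>k\<in>V. w i j * w j k * (f i * (g j * h k - g k * h j)))
    - (\<Sum>j\<in>V. \<Sum>k\<in>V. w i j * w i k * (f j * (g i * h k - g k * h i)))"
proof -
  have "graph_bracket V w f (graph_bracket V w g h) i =
    (\<Sum>j\<in>V. w i j * (f i * (\<Sum>k\<in>V. w j k * (g j * h k - g k * h j))
      - f j * (\<Sum>k\<in>V. w i k * (g i * h k - g k * h i))))"
    using assms by (simp add: graph_bracket_def)
  also have "\<dots> = (\<Sum>j\<in>V. (\<Sum>k\<in>V. w i j * w j k * (f i * (g j * h k - g k * h j)))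
      - (\<Sum>k\<in>V. w i j * w i k * (f j * (g i * h k - g k * h i))))"
    by (intro sum.cong refl) (simp only: right_diff_distrib sum_distrib_left sum_subtractf ac_simps)
  finally show ?thesis
    by (simp only: sum_subtractf)
qed

text \<open>Exchanging the two summation indices turns one half of the sum into the other. Nothing
  is divided by 2, so characteristic 2 is covered.\<close>

lemma sum_symmetric_times_antisymmetric:
  fixes S P :: "'v \<Rightarrow> 'v \<Rightarrow> 'a::comm_ring"
  assumes "\<And>j k. j \<in> V \<Longrightarrow> k \<in> V \<Longrightarrow> S j k = S k j"
  shows "(\<Sum>j\<in>V. \<Sum>k\<in>V. S j k * (P j k - P k j)) = 0"
proof -
  have "(\<Sum>j\<in>V. \<Sum>k\<in>V. S j k * P k j) = (\<Sum>j\<in>V. \<Sum>k\<in>V. S k j * P k j)"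
    using assms by (intro sum.cong refl) metis
  also have "\<dots> = (\<Sum>j\<in>V. \<Sum>k\<in>V. S j k * P j k)"
    by (rule sum.swap)
  finally show ?thesis
    by (simp add: right_diff_distrib sum_subtractf)
qed

lemma graph_bracket_jacobiator:
  fixes w :: "'v \<Rightarrow> 'v \<Rightarrow> 'a::{comm_ring, comm_monoid_mult}"
  assumes "i \<in> V"
  shows "graph_bracket V w f (graph_bracket V w g h) i
      + graph_bracket V w g (graph_bracket V w h f) i
      + graph_bracket V w h (graph_bracket V w f g) i =
    (\<Sum>j\<in>V. \<Sum>k\<in>V. w i j * w j k *
      (f i * (g j * h k - g k * h j) + g i * (h j * f k - h k * f j)
        + h i * (f j * g k - f k * g j)))"
proof -
  \<comment> \<open>Three of the six monomials of the cyclic sum; the other three are those of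
    \<open>?P k j\<close>, with opposite sign.\<close>
  let ?P = "\<lambda>j k. g i * f j * h k + h i * g j * f k + f i * h j * g k"
  have "(\<Sum>j\<in>V. \<Sum>k\<in>V. w i j * w i k * (f j * (g i * h k - g k * h i)))
      + (\<Sum>j\<in>V. \<Sum>k\<in>V. w i j * w i k * (g j * (h i * f k - h k * f i)))
      + (\<Sum>j\<in>V. \<Sum>k\<in>V. w i j * w i k * (h j * (f i * g k - f k * g i)))
      = (\<Sum>j\<in>V. \<Sum>k\<in>V. w i j * w i k * (?P j k - ?P k j))"
    unfolding sum.distrib[symmetric]
    by (intro sum.cong refl) (simp add: algebra_simps)
  also have "\<dots> = 0"
    by (rule sum_symmetric_times_antisymmetric) (rule mult.commute)
  finally have cancel: "(\<Sum>j\<in>V. \<Sum>k\<in>V. w i j * w i k * (f j * (g i * h k - g k * h i)))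
      + (\<Sum>j\<in>V. \<Sum>k\<in>V. w i j * w i k * (g j * (h i * f k - h k * f i)))
      + (\<Sum>j\<in>V. \<Sum>k\<in>V. w i j * w i k * (h j * (f i * g k - f k * g i))) = 0" .
  have rearrange: "(a - x) + (b - y) + (c - z) = a + b + c" if "x + y + z = 0"
    for a b c x y z :: 'a
  proof -
    have "(a - x) + (b - y) + (c - z) = a + b + c - (x + y + z)"
      by (simp add: algebra_simps)
    with that show ?thesis by simp
  qed
  show ?thesis
    unfolding graph_bracket_nested[OF assms] rearrange[OF cancel] sum.distrib[symmetric]
    by (simp only: distrib_left)
qed

text \<open>One equation stands for all three, since it is imposed for every ordering of the
  vertices. It says that the walks \<open>a\<close>, \<open>b\<close>, \<open>c\<close> and
  \<open>a\<close>, \<open>c\<close>, \<open>b\<close> carry the same weight.\<close>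

lemma jacobi_identity_graph_bracketI:
  fixes w :: "'v \<Rightarrow> 'v \<Rightarrow> 'a::{comm_ring, comm_monoid_mult}"
  assumes sym: "\<And>i j. i \<in> V \<Longrightarrow> j \<in> V \<Longrightarrow> w i j = w j i"
    and triple: "\<And>a b c. a \<in> V \<Longrightarrow> b \<in> V \<Longrightarrow> c \<in> V \<Longrightarrow> a \<noteq> b \<Longrightarrow> b \<noteq> c \<Longrightarrow> a \<noteq> c \<Longrightarrow>
      w b c * (w a b - w a c) = 0"
  shows "jacobi_identity V (graph_bracket V w)"
  unfolding jacobi_identity_def
proof (intro ballI)
  fix f g h :: "'v \<Rightarrow> 'a" and i
  assume i: "i \<in> V"
  \<comment> \<open>If \<open>j = i\<close> or \<open>k = i\<close>, the determinant has a repeated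
    column and vanishes, but \<open>w i j * w j k\<close> may fail to be symmetric there; replacing
    it by 0 restores symmetry.\<close>
  let ?S = "\<lambda>j k. if j = i \<or> k = i then 0 else w i j * w j k"
  let ?P = "\<lambda>j k. f i * g j * h k + g i * h j * f k + h i * f j * g k"
  have "(\<Sum>j\<in>V. \<Sum>k\<in>V. w i j * w j k *
      (f i * (g j * h k - g k * h j) + g i * (h j * f k - h k * f j)
        + h i * (f j * g k - f k * g j)))
      = (\<Sum>j\<in>V. \<Sum>k\<in>V. ?S j k * (?P j k - ?P k j))"
    by (intro sum.cong refl) (auto simp: algebra_simps)
  also have "\<dots> = 0"
  proof (rule sum_symmetric_times_antisymmetric)
    fix j k assume jk: "j \<in> V" "k \<in> V"
    have "w i j * w j k = w i k * w k j" if "j \<noteq> i" "k \<noteq> i" "j \<noteq> k"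
      using triple[of i j k] sym[of j k] i jk that by (simp add: right_diff_distrib mult.commute)
    then show "?S j k = ?S k j" by auto
  qed
  finally show "graph_bracket V w f (graph_bracket V w g h) i
      + graph_bracket V w g (graph_bracket V w h f) i
      + graph_bracket V w h (graph_bracket V w f g) i = 0"
    by (simp only: graph_bracket_jacobiator[OF i])
qed

lemma jacobi_identity_graph_bracketD:
  fixes w :: "'v \<Rightarrow> 'v \<Rightarrow> 'a::{comm_ring, comm_monoid_mult}"
  assumes "finite V"
    and jacobi: "jacobi_identity V (graph_bracket V w)"
    and V: "a \<in> V" "b \<in> V" "c \<in> V" and distinct: "a \<noteq> b" "b \<noteq> c" "a \<noteq> c"
  shows "w a b * w b c = w a c * w c b"
proof -
  define e :: "'v \<Rightarrow> 'v \<Rightarrow> 'a" where "e x = (\<lambda>y\<in>V. if y = x then 1 else 0)" for x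
  have e: "e x y = (if y = x then 1 else 0)" if "y \<in> V" for x y
    using that by (simp add: e_def)
  have "e x \<in> V \<rightarrow>\<^sub>E UNIV" for x
    by (simp add: e_def)
  then have "0 = (\<Sum>j\<in>V. \<Sum>k\<in>V. w a j * w j k *
      (e a a * (e b j * e c k - e b k * e c j) + e b a * (e c j * e a k - e c k * e a j)
        + e c a * (e a j * e b k - e a k * e b j)))"
    using jacobi V unfolding jacobi_identity_def
    by (simp only: graph_bracket_jacobiator[OF V(1), symmetric])
  \<comment> \<open>Since \<open>e b\<close> and \<open>e c\<close> vanish at \<open>a\<close>, only
    their minor at \<open>j\<close>, \<open>k\<close> remains: 1 at \<open>(b, c)\<close>, -1 at
    \<open>(c, b)\<close>, 0 elsewhere. The test on \<open>k\<close> stands outermost so that the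
    inner sum collapses first.\<close>
  also have "\<dots> = (\<Sum>j\<in>V. \<Sum>k\<in>V. (if k = c then if j = b then w a b * w b c else 0 else 0)
      - (if k = b then if j = c then w a c * w c b else 0 else 0))"
    using V distinct by (intro sum.cong refl) (auto simp: e)
  also have "\<dots> = w a b * w b c - w a c * w c b"
    using V \<open>finite V\<close> by (simp add: sum_subtractf)
  finally show ?thesis by simp
qed

theorem theorem2p1:
  fixes G :: "('v, 'e) pre_digraph"
    and w :: "'v \<Rightarrow> 'v \<Rightarrow> 'a::{comm_ring, comm_monoid_mult}"
  assumes "graph G"
    and "\<And>i j. i \<in> verts G \<Longrightarrow> j \<in> verts G \<Longrightarrow> w i j = w j i"
    and "\<And>i. i \<in> verts G \<Longrightarrow> w i i = 0"
    and "\<And>i j. i \<in> verts G \<Longrightarrow> j \<in> verts G \<Longrightarrow> \<not> i \<rightarrow>\<^bsub>G\<^esub> j \<Longrightarrow> w i j = 0"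
  shows "(jacobi_identity (verts G) (graph_bracket (verts G) w) \<longleftrightarrow>
           (\<forall>a\<in>verts G. \<forall>b\<in>verts G. \<forall>c\<in>verts G.
              a \<noteq> b \<and> b \<noteq> c \<and> a \<noteq> c \<longrightarrow>
                w b c * (w a b - w a c) = 0 \<and>
                w a c * (w b c - w a b) = 0 \<and>
                w a b * (w a c - w b c) = 0))
       \<and> (incident_annihilation (verts G) w \<longrightarrow>
            jacobi_identity (verts G) (graph_bracket (verts G) w))"
proof -
  interpret graph G by fact
  let ?V = "verts G"
  note sym = assms(2)
  let ?triples = "\<forall>a\<in>?V. \<forall>b\<in>?V. \<forall>c\<in>?V. a \<noteq> b \<and> b \<noteq> c \<and> a \<noteq> c \<longrightarrow>
    w b c * (w a b - w a c) = 0 \<and> w a c * (w b c - w a b) = 0 \<and> w a b * (w a c - w b c) = 0"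
  have necessary: ?triples if jacobi: "jacobi_identity ?V (graph_bracket ?V w)"
  proof (intro ballI impI)
    fix a b c
    assume V: "a \<in> ?V" "b \<in> ?V" "c \<in> ?V" and distinct: "a \<noteq> b \<and> b \<noteq> c \<and> a \<noteq> c"
    note eq = jacobi_identity_graph_bracketD[OF finite_verts jacobi]
    \<comment> \<open>Comparing the walks from \<open>a\<close> and those from \<open>b\<close>
      makes all three products of two of the weights equal, which is what the three equations
      say.\<close>
    have "w a b * w b c = w a c * w b c" "w b c * w a c = w a b * w a c"
      using eq[of a b c] eq[of b c a] sym[of b c] sym[of a b] sym[of a c] V distinct
      by (auto simp: mult.commute)
    then show "w b c * (w a b - w a c) = 0 \<and> w a c * (w b c - w a b) = 0
        \<and> w a b * (w a c - w b c) = 0"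
      by (simp add: right_diff_distrib mult.commute)
  qed
  have sufficient: "jacobi_identity ?V (graph_bracket ?V w)" if ?triples
    using that by (intro jacobi_identity_graph_bracketI sym) blast+
  have "jacobi_identity ?V (graph_bracket ?V w)" if "incident_annihilation ?V w"
  proof (rule jacobi_identity_graph_bracketI)
    fix a b c
    assume V: "a \<in> ?V" "b \<in> ?V" "c \<in> ?V" and "a \<noteq> b" "b \<noteq> c" "a \<noteq> c"
    \<comment> \<open>In this form the two weights of each product meet at one vertex,
      \<open>b\<close> or \<open>c\<close>, and have distinct other ends.\<close>
    then have "w b c * w b a = 0" "w c b * w c a = 0"
      using that unfolding incident_annihilation_def by metis+
    then show "w b c * (w a b - w a c) = 0"
      using sym[of a b] sym[of b c] sym[of a c] V by (simp add: right_diff_distrib)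
  qed (rule sym)
  with necessary sufficient show ?thesis by blast
qed

end
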